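(* Let $\mathcal{M}=(E,\mathcal{T})$ be a simple oriented matroid that is not acyclic, on ground set $E$, with set of topes $\mathcal{T}$. Let $\#\mathbf{K}_3^{\ast}(\mathcal{M})$ and $\#\mathbf{A}_3^{\ast}(\mathcal{M})$ be the numbers of tope committees and of tope anti-committees of cardinality $3$ for $\mathcal{M}$, respectively, and let $\widehat{L}$ be the lattice of convex subsets of $E$ augmented by the greatest element $\hat{1}:=E$. Then $$\#\mathbf{K}_3^{\ast}(\mathcal{M})=\#\mathbf{A}_3^{\ast}(\mathcal{M})=\sum_{\substack{\{A_1,A_2,A_3\}\subset \widehat{L}-\{\hat{0},\hat{1}\}:\\ A_1\wedge A_2=A_1\wedge A_3=A_2\wedge A_3=\hat{0}}}\ \prod_{k\in\{1,2,3\}}\Bigl|\mathcal{T}_{\mathrm{ex}(A_k)}^+\cap\bigl(-\mathcal{T}_{\mathrm{ex}(\mathrm{conv}(E-A_k))}^+\bigr)\Bigr|,$$ where the sum is over unordered triples (3-element subsets) $\{A_1,A_2,A_3\}$.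
   Context: An oriented matroid is called simple here if it has no loops, no parallel elements and no antiparallel elements. Topes are the maximal covectors, regarded as sign vectors $T\in\{+,-\}^E$. $\mathcal{M}$ is acyclic if it has the tope all of whose components are $+$. For a set of sign vectors $\mathcal{F}$, $-\mathcal{F}:=\{-F: F\in\mathcal{F}\}$. For $e\in E$, the positive halfspace is $\mathcal{T}_e^+:=\{T\in\mathcal{T}: T(e)=+\}$, and for $B\subseteq E$, $\mathcal{T}_B^+:=\bigcap_{b\in B}\mathcal{T}_b^+$. A tope committee for $\mathcal{M}$ is a subset $\mathcal{K}^{\ast}\subset\mathcal{T}$ such that $|\mathcal{T}_e^+\cap\mathcal{K}^{\ast}|>\frac12|\mathcal{K}^{\ast}|$ for every $e\in E$. A tope anti-committee for $\mathcal{M}$ is a subset $\mathcal{A}^{\ast}\subset\mathcal{T}$ such that $-\mathcal{A}^{\ast}$ is a tope committee for $\mathcal{M}$. $\mathbf{K}_k^{\ast}(\mathcal{M})$ and $\mathbf{A}_k^{\ast}(\mathcal{M})$ denote the families of all tope committees and anti-committees of cardinality $k$; $\#$ denotes the number of sets in a family. A subset $A\subset E$ is acyclic if the restriction of $\mathcal{M}$ to $A$ is an acyclic oriented matroid. The convex hull $\mathrm{conv}(A)$ of an acyclic set $A$ is the set of all $b\in E$ such that for every covector $F$ of $\mathcal{M}$, if $F(a)=+$ for all $a\in A$ then $F(b)=+$. An acyclic set $A$ is convex if $\mathrm{conv}(A)=A$; its set of extreme points is $\mathrm{ex}(A):=\{a\in A: a\notin\mathrm{conv}(A-\{a\})\}$.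 If $H\subseteq E$ is not acyclic, one sets $\mathrm{conv}(H):=E$, and one sets $\mathrm{ex}(E):=E$. The convex subsets of $E$ ordered by inclusion form a meet-semilattice with least element $\hat{0}$ the empty set; $\widehat{L}$ is this poset with a greatest element $\hat{1}:=E$ adjoined, and $\wedge$ denotes its meet. *)

theory Defs
  imports Complex_Main "HOL-Algebra.Lattice"
begin

datatype sign = Neg | Zero | Pos

instantiation sign :: uminus
begin

fun uminus_sign :: "sign \<Rightarrow> sign" where
  "- Neg = Pos"
| "- Zero = Zero"
| "- Pos = Neg"

instance ..

end

text \<open>
  A sign vector on a ground set \<open>E\<close> is a function \<open>'e \<Rightarrow> sign\<close> that is \<open>Zero\<close> outside \<open>E\<close>;
  negation of sign vectors is the pointwise \<open>uminus\<close> on functions.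
\<close>

type_synonym 'e sign_vector = "'e \<Rightarrow> sign"

definition sv_comp :: "'e sign_vector \<Rightarrow> 'e sign_vector \<Rightarrow> 'e sign_vector" where
  "sv_comp X Y = (\<lambda>e. if X e \<noteq> Zero then X e else Y e)"

definition separation :: "'e sign_vector \<Rightarrow> 'e sign_vector \<Rightarrow> 'e set" where
  "separation X Y = {e. X e \<noteq> Zero \<and> X e = - Y e}"

definition sv_le :: "'e sign_vector \<Rightarrow> 'e sign_vector \<Rightarrow> bool" where
  "sv_le X Y \<longleftrightarrow> (\<forall>e. X e = Zero \<or> X e = Y e)"

text \<open>The covector axioms of an oriented matroid with ground set \<open>E\<close> and covectors \<open>L\<close>.\<close>

locale oriented_matroid =
  fixes E :: "'e set" and L :: "'e sign_vector set"
  assumes finite_ground: "finite E"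
    and support: "\<And>X e. X \<in> L \<Longrightarrow> e \<notin> E \<Longrightarrow> X e = Zero"
    and zero_covector: "(\<lambda>_. Zero) \<in> L"
    and symmetry: "\<And>X. X \<in> L \<Longrightarrow> - X \<in> L"
    and composition: "\<And>X Y. X \<in> L \<Longrightarrow> Y \<in> L \<Longrightarrow> sv_comp X Y \<in> L"
    and elimination: "\<And>X Y e. X \<in> L \<Longrightarrow> Y \<in> L \<Longrightarrow> e \<in> separation X Y \<Longrightarrow>
      \<exists>Z\<in>L. Z e = Zero \<and> (\<forall>f\<in>E - separation X Y. Z f = sv_comp X Y f)"

locale simple_oriented_matroid = oriented_matroid +
  assumes no_loops: "\<And>e. e \<in> E \<Longrightarrow> \<exists>X\<in>L. X e \<noteq> Zero"
    and no_parallel: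
      "\<And>e f. e \<in> E \<Longrightarrow> f \<in> E \<Longrightarrow> e \<noteq> f \<Longrightarrow> \<exists>X\<in>L. X e \<noteq> X f"
    and no_antiparallel:
      "\<And>e f. e \<in> E \<Longrightarrow> f \<in> E \<Longrightarrow> e \<noteq> f \<Longrightarrow> \<exists>X\<in>L. X e \<noteq> - X f"

definition topes :: "'e sign_vector set \<Rightarrow> 'e sign_vector set" where
  "topes L = {T \<in> L. \<forall>X\<in>L. sv_le T X \<longrightarrow> X = T}"

definition acyclic_om :: "'e set \<Rightarrow> 'e sign_vector set \<Rightarrow> bool" where
  "acyclic_om E L \<longleftrightarrow> (\<exists>T\<in>topes L. \<forall>e\<in>E. T e = Pos)"

definition restriction :: "'e sign_vector set \<Rightarrow> 'e set \<Rightarrow> 'e sign_vector set" where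
  "restriction L A = (\<lambda>X e. if e \<in> A then X e else Zero) ` L"

definition acyclic_set :: "'e set \<Rightarrow> 'e sign_vector set \<Rightarrow> 'e set \<Rightarrow> bool" where
  "acyclic_set E L A \<longleftrightarrow> A \<subseteq> E \<and> acyclic_om A (restriction L A)"

definition pos_halfspace :: "'e sign_vector set \<Rightarrow> 'e \<Rightarrow> 'e sign_vector set" where
  "pos_halfspace L e = {T \<in> topes L. T e = Pos}"

text \<open>The intersection with \<open>topes L\<close> makes the empty intersection the set of all topes.\<close>

definition pos_region :: "'e sign_vector set \<Rightarrow> 'e set \<Rightarrow> 'e sign_vector set" where
  "pos_region L B = topes L \<inter> (\<Inter>b\<in>B. pos_halfspace L b)"

definition tope_committee :: "'e set \<Rightarrow> 'e sign_vector set \<Rightarrow> 'e sign_vector set \<Rightarrow> bool" where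
  "tope_committee E L K \<longleftrightarrow> K \<subseteq> topes L \<and>
     (\<forall>e\<in>E. real (card (pos_halfspace L e \<inter> K)) > 1 / 2 * real (card K))"

text \<open>
  The set \<open>{-T | T \<in> K}\<close> is written as an image, since \<open>- K\<close> is the complement in HOL.
\<close>

definition tope_anticommittee :: "'e set \<Rightarrow> 'e sign_vector set \<Rightarrow> 'e sign_vector set \<Rightarrow> bool" where
  "tope_anticommittee E L K \<longleftrightarrow> K \<subseteq> topes L \<and> tope_committee E L (uminus ` K)"

definition committees :: "nat \<Rightarrow> 'e set \<Rightarrow> 'e sign_vector set \<Rightarrow> 'e sign_vector set set" where
  "committees k E L = {K. tope_committee E L K \<and> card K = k}"

definition anticommittees :: "nat \<Rightarrow> 'e set \<Rightarrow> 'e sign_vector set \<Rightarrow> 'e sign_vector set set" where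
  "anticommittees k E L = {K. tope_anticommittee E L K \<and> card K = k}"

definition om_conv :: "'e set \<Rightarrow> 'e sign_vector set \<Rightarrow> 'e set \<Rightarrow> 'e set" where
  "om_conv E L A =
     (if acyclic_set E L A
      then {b \<in> E. \<forall>F\<in>L. (\<forall>a\<in>A. F a = Pos) \<longrightarrow> F b = Pos}
      else E)"

definition om_convex :: "'e set \<Rightarrow> 'e sign_vector set \<Rightarrow> 'e set \<Rightarrow> bool" where
  "om_convex E L A \<longleftrightarrow> acyclic_set E L A \<and> om_conv E L A = A"

text \<open>
  Extreme points are only meant for convex sets and for \<open>E\<close>; the convention \<open>ex(E) = E\<close>
  belongs to the case that \<open>E\<close> is not acyclic.
\<close>

definition extreme_points :: "'e set \<Rightarrow> 'e sign_vector set \<Rightarrow> 'e set \<Rightarrow> 'e set" where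
  "extreme_points E L A =
     (if A = E \<and> \<not> acyclic_set E L E then E
      else {a \<in> A. a \<notin> om_conv E L (A - {a})})"

definition convex_lattice :: "'e set \<Rightarrow> 'e sign_vector set \<Rightarrow> 'e set gorder" where
  "convex_lattice E L =
     \<lparr>carrier = insert E {A. om_convex E L A}, eq = (=), le = (\<subseteq>)\<rparr>"

end

theory Submission
  imports Defs
begin

text \<open>
  A tope is determined by its positive part, and three topes form an anti-committee exactly
  when their positive parts are pairwise disjoint. By the Krein--Milman property
  (\<open>A\<close> lies in the hull of its extreme points), the factor belonging to a convex set \<open>A\<close> counts
  the topes that are positive on \<open>A\<close> and negative on \<open>E - A\<close>; so it is \<open>1\<close> if \<open>A\<close> is the positive
  part of a tope and \<open>0\<close> otherwise.
\<close>

section \<open>Signs, sign vectors and indicators\<close>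

lemma sign_uminus_uminus [simp]: "- (- s) = (s :: sign)"
  by (cases s) auto

lemma sign_uminus_eq_iff [simp]:
  "- s = Pos \<longleftrightarrow> s = Neg" "- s = Neg \<longleftrightarrow> s = Pos" "- s = Zero \<longleftrightarrow> s = Zero"
  by (cases s; auto)+

lemma sign_vector_uminus_uminus [simp]: "- (- X) = (X :: 'e sign_vector)"
  by (simp add: fun_eq_iff)

lemma uminus_image_uminus_image [simp]: "uminus ` uminus ` K = (K :: 'e sign_vector set)"
  by (simp add: image_image)

lemma inj_uminus_sign_vector: "inj (uminus :: 'e sign_vector \<Rightarrow> _)"
  by (metis injI sign_vector_uminus_uminus)

text \<open>Turns the indicator of a triple of positive parts into a product with one factor per
  set.\<close>

lemma of_bool_subset_eq_prod:
  "finite S \<Longrightarrow> of_bool (S \<subseteq> P) = (\<Prod>A\<in>S. of_bool (A \<in> P) :: nat)"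
  by (induction rule: finite_induct) auto

definition pos_part :: "'e sign_vector \<Rightarrow> 'e set" where
  "pos_part X = {e. X e = Pos}"

section \<open>Negation of topes, acyclic sets and convex hulls\<close>

context oriented_matroid
begin

lemma uminus_topes: "T \<in> topes L \<Longrightarrow> - T \<in> topes L"
proof -
  assume T: "T \<in> topes L"
  have "X = - T" if X: "X \<in> L" and le: "sv_le (- T) X" for X
  proof -
    have "T e = Zero \<or> T e = - X e" for e
      using le[unfolded sv_le_def, rule_format, of e] by (cases "T e"; cases "X e") auto
    hence "sv_le T (- X)"
      by (simp add: sv_le_def)
    hence "- X = T"
      using T symmetry[OF X] by (auto simp: topes_def)
    thus ?thesis
      by auto
  qed
  thus ?thesis
    using T symmetry by (auto simp: topes_def)
qed

lemma pos_part_subset: "X \<in> L \<Longrightarrow> pos_part X \<subseteq> E"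
  using support by (force simp: pos_part_def)

text \<open>A tope of the restriction is a restricted covector. Conversely, a covector positive on
  \<open>A\<close>, cut down to \<open>A\<close>, has no zero left to fill there, so it is
  maximal.\<close>

lemma acyclic_set_iff: "acyclic_set E L A \<longleftrightarrow> A \<subseteq> E \<and> (\<exists>F\<in>L. \<forall>a\<in>A. F a = Pos)"
proof
  assume "acyclic_set E L A"
  thus "A \<subseteq> E \<and> (\<exists>F\<in>L. \<forall>a\<in>A. F a = Pos)"
    by (auto simp: acyclic_set_def acyclic_om_def topes_def restriction_def)
next
  assume "A \<subseteq> E \<and> (\<exists>F\<in>L. \<forall>a\<in>A. F a = Pos)"
  then obtain F where A: "A \<subseteq> E" and F: "F \<in> L" "\<forall>a\<in>A. F a = Pos"
    by blast
  let ?F = "\<lambda>e. if e \<in> A then F e else Zero"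
  have "?F \<in> topes (restriction L A)"
    using F by (fastforce simp: topes_def restriction_def sv_le_def fun_eq_iff)
  thus "acyclic_set E L A"
    using A F unfolding acyclic_set_def acyclic_om_def by (intro conjI bexI[of _ ?F]) auto
qed

lemma acyclic_set_mono: "acyclic_set E L A \<Longrightarrow> B \<subseteq> A \<Longrightarrow> acyclic_set E L B"
  by (auto simp: acyclic_set_iff)

lemma om_conv_acyclic:
  assumes "acyclic_set E L A"
  shows "om_conv E L A = {b \<in> E. \<forall>F\<in>L. (\<forall>a\<in>A. F a = Pos) \<longrightarrow> F b = Pos}"
  using assms by (simp add: om_conv_def)

lemma subset_om_conv: "acyclic_set E L A \<Longrightarrow> A \<subseteq> om_conv E L A"
  by (auto simp: om_conv_acyclic acyclic_set_def)

lemma pos_on_om_conv: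
  "acyclic_set E L A \<Longrightarrow> F \<in> L \<Longrightarrow> \<forall>a\<in>A. F a = Pos \<Longrightarrow> \<forall>a\<in>om_conv E L A. F a = Pos"
  by (auto simp: om_conv_acyclic)

text \<open>Every covector positive on \<open>A\<close> is positive on the hull. So the witness for
  \<open>A\<close> also shows that the hull is acyclic, and taking the hull again adds
  nothing.\<close>

lemma om_convex_om_conv:
  assumes "acyclic_set E L A"
  shows "om_convex E L (om_conv E L A)"
proof -
  have ac: "acyclic_set E L (om_conv E L A)"
    using assms pos_on_om_conv[OF assms] unfolding acyclic_set_iff[of "om_conv E L A"]
    by (auto simp: om_conv_acyclic acyclic_set_iff)
  moreover have "om_conv E L (om_conv E L A) \<subseteq> om_conv E L A"
    using pos_on_om_conv[OF assms] unfolding om_conv_acyclic[OF ac]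
    by (auto simp: om_conv_acyclic[OF assms])
  ultimately show ?thesis
    using subset_om_conv[OF ac] by (auto simp: om_convex_def)
qed

lemma om_convex_Int:
  assumes "om_convex E L A" "om_convex E L B"
  shows "om_convex E L (A \<inter> B)"
proof -
  have ac: "acyclic_set E L A" "acyclic_set E L B" "acyclic_set E L (A \<inter> B)"
    using assms acyclic_set_mono by (auto simp: om_convex_def)
  have "om_conv E L (A \<inter> B) \<subseteq> om_conv E L A \<inter> om_conv E L B"
    using ac by (auto simp: om_conv_acyclic)
  thus ?thesis
    using assms ac(3) subset_om_conv[OF ac(3)] by (auto simp: om_convex_def)
qed

text \<open>The zero covector is vacuously positive on the empty set and positive nowhere, which
  keeps every element out of the hull.\<close>

lemma om_convex_empty: "om_convex E L {}"
proof -
  have "acyclic_set E L {}"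
    using zero_covector by (auto simp: acyclic_set_iff)
  thus ?thesis
    using zero_covector by (auto simp: om_convex_def om_conv_acyclic)
qed

text \<open>\<open>X\<close> itself witnesses acyclicity, and it excludes from the hull every
  element where it is not \<open>Pos\<close>.\<close>

lemma om_convex_pos_part:
  assumes "X \<in> L"
  shows "om_convex E L (pos_part X)"
proof -
  have ac: "acyclic_set E L (pos_part X)"
    using assms pos_part_subset[OF assms] by (auto simp: acyclic_set_iff pos_part_def)
  have "\<forall>a\<in>om_conv E L (pos_part X). X a = Pos"
    using pos_on_om_conv[OF ac assms] by (simp add: pos_part_def)
  hence "om_conv E L (pos_part X) \<subseteq> pos_part X"
    by (auto simp: pos_part_def)
  thus ?thesis
    using ac subset_om_conv[OF ac] by (simp add: om_convex_def subset_antisym)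
qed

section \<open>The lattice of convex sets\<close>

lemma partial_order_convex_lattice: "partial_order (convex_lattice E L)"
  by unfold_locales (auto simp: convex_lattice_def)

text \<open>\<open>bottom\<close> is a Hilbert choice; uniqueness of the least element in a partial
  order identifies it with \<open>{}\<close>. Top and meet are identified in the same way.\<close>

lemma convex_lattice_bottom: "\<bottom>\<^bsub>convex_lattice E L\<^esub> = {}"
proof -
  interpret C: partial_order "convex_lattice E L"
    by (rule partial_order_convex_lattice)
  have "least (convex_lattice E L) {} (carrier (convex_lattice E L))"
    using om_convex_empty by (auto simp: least_def convex_lattice_def)
  thus ?thesis
    unfolding bottom_def using C.least_unique by (metis someI)
qed

lemma convex_lattice_top: "\<top>\<^bsub>convex_lattice E L\<^esub> = E"
proof -
  interpret C: partial_order "convex_lattice E L"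
    by (rule partial_order_convex_lattice)
  have "greatest (convex_lattice E L) E (carrier (convex_lattice E L))"
    by (auto simp: greatest_def convex_lattice_def om_convex_def acyclic_set_def)
  thus ?thesis
    unfolding top_def using C.greatest_unique by (metis someI)
qed

lemma convex_lattice_meet:
  assumes "om_convex E L A" "om_convex E L B"
  shows "A \<sqinter>\<^bsub>convex_lattice E L\<^esub> B = A \<inter> B"
proof -
  interpret C: partial_order "convex_lattice E L"
    by (rule partial_order_convex_lattice)
  have "greatest (convex_lattice E L) (A \<inter> B) (Lower (convex_lattice E L) {A, B})"
    using assms om_convex_Int[OF assms]
    by (auto simp: greatest_def Lower_def convex_lattice_def)
  thus ?thesis
    unfolding meet_def inf_def using C.greatest_unique by (metis someI)
qed

end

section \<open>Topes of a simple oriented matroid\<close>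

context simple_oriented_matroid
begin

text \<open>Composing \<open>T\<close> with a covector nonzero at \<open>e\<close> only fills zeros
  of \<open>T\<close>; maximality forbids any change, so \<open>T\<close> has no zero at
  \<open>e\<close>.\<close>

lemma tope_nonzero:
  assumes "T \<in> topes L" "e \<in> E"
  shows "T e \<noteq> Zero"
proof -
  obtain X where X: "X \<in> L" "X e \<noteq> Zero"
    using no_loops assms by blast
  have "T \<in> L" and max: "\<And>Y. Y \<in> L \<Longrightarrow> sv_le T Y \<Longrightarrow> Y = T"
    using assms by (auto simp: topes_def)
  hence "sv_comp T X = T"
    using composition X by (auto simp: sv_le_def sv_comp_def)
  thus ?thesis
    using X by (metis sv_comp_def)
qed

lemma full_support_tope:
  assumes "T \<in> L" "\<forall>e\<in>E. T e \<noteq> Zero"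
  shows "T \<in> topes L"
proof -
  have "X = T" if "X \<in> L" "sv_le T X" for X
    using that assms support unfolding sv_le_def fun_eq_iff by metis
  thus ?thesis
    using assms by (auto simp: topes_def)
qed

text \<open>Topes vanish exactly outside \<open>E\<close>, so the places of \<open>Pos\<close>
  settle all other signs.\<close>

lemma inj_on_pos_part: "inj_on pos_part (topes L)"
proof (rule inj_onI, rule ext)
  fix S T e
  assume *: "S \<in> topes L" "T \<in> topes L" "pos_part S = pos_part T"
  have "S e = Pos \<longleftrightarrow> T e = Pos"
    using * by (auto simp: pos_part_def set_eq_iff)
  moreover have "S e = Zero \<longleftrightarrow> T e = Zero"
    using * tope_nonzero support by (metis (no_types, lifting) mem_Collect_eq topes_def)
  ultimately show "S e = T e"
    by (cases "S e"; cases "T e") auto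
qed

lemma pos_part_uminus:
  assumes "T \<in> topes L"
  shows "pos_part (- T) = E - pos_part T"
proof -
  have "T \<in> L"
    using assms by (simp add: topes_def)
  have "T e = Neg \<longleftrightarrow> e \<in> E \<and> T e \<noteq> Pos" for e
    using tope_nonzero[OF assms, of e] support[OF \<open>T \<in> L\<close>, of e] by (cases "T e") auto
  thus ?thesis
    by (auto simp: pos_part_def)
qed

section \<open>Extreme points generate convex sets\<close>

text \<open>
  If \<open>b\<close> is not in the hull of the other elements of a generating set \<open>B\<close>, elimination yields a
  covector \<open>F\<close> that vanishes at \<open>b\<close> and is positive on \<open>B - {b}\<close>. It is nonnegative on \<open>A\<close>, and a
  second zero \<open>a \<in> A\<close> of \<open>F\<close> would be parallel to \<open>b\<close>.
\<close>

lemma irredundant_extreme: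
  assumes A: "om_convex E L A" and B: "B \<subseteq> A" "A \<subseteq> om_conv E L B"
    and b: "b \<in> B" "b \<notin> om_conv E L (B - {b})"
  shows "b \<notin> om_conv E L (A - {b})"
proof -
  have acA: "acyclic_set E L A"
    using A by (simp add: om_convex_def)
  have ac: "acyclic_set E L B" "acyclic_set E L (B - {b})" "acyclic_set E L (A - {b})"
    using acA B by (auto intro: acyclic_set_mono)
  have AE: "A \<subseteq> E"
    using acA by (simp add: acyclic_set_def)
  have gen: "X a = Pos" if "X \<in> L" "\<forall>x\<in>B. X x = Pos" "a \<in> A" for X a
    using pos_on_om_conv[OF ac(1) that(1,2)] that(3) B by blast
  obtain P where P: "P \<in> L" "\<forall>a\<in>A. P a = Pos"
    using acA by (auto simp: acyclic_set_iff)
  have Pb: "P b = Pos"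
    using P B b by auto
  obtain F where F: "F \<in> L" "\<forall>x\<in>B - {b}. F x = Pos" "F b = Zero"
  proof -
    obtain G where G: "G \<in> L" "\<forall>x\<in>B - {b}. G x = Pos" "G b \<noteq> Pos"
      using b AE B ac(2) by (auto simp: om_conv_acyclic)
    show thesis
    proof (cases "G b")
      case Zero
      thus ?thesis
        using G that by blast
    next
      case Neg
      hence "b \<in> separation P G"
        using Pb by (simp add: separation_def)
      then obtain Z where Z: "Z \<in> L" "Z b = Zero"
        "\<forall>f\<in>E - separation P G. Z f = sv_comp P G f"
        using elimination P G by blast
      have "Z x = Pos" if x: "x \<in> B - {b}" for x
      proof -
        have "P x = Pos" "G x = Pos" "x \<in> E"
          using x P G B AE by auto
        thus ?thesis
          using Z by (auto simp: separation_def sv_comp_def)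
      qed
      thus ?thesis
        using Z that by blast
    qed (use G in simp)
  qed
  \<comment> \<open>\<open>X\<close> fills the zero of \<open>F\<close> at \<open>b\<close>, so the
    composition is \<open>Pos\<close> on the generating set \<open>B\<close> and hence on
    \<open>A\<close>.\<close>
  have comp_gen: "sv_comp F X a = Pos" if "X \<in> L" "X b = Pos" "a \<in> A" for X a
  proof (rule gen[OF composition[OF F(1) that(1)] _ that(3)])
    have "sv_comp F X x = Pos" if "x \<in> B" for x
      using F \<open>X b = Pos\<close> that by (cases "x = b") (auto simp: sv_comp_def)
    thus "\<forall>x\<in>B. sv_comp F X x = Pos"
      by blast
  qed
  have "F a = Pos" if a: "a \<in> A - {b}" for a
  proof (rule ccontr)
    assume "F a \<noteq> Pos"
    hence F0: "F a = Zero"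
      using comp_gen[OF P(1) Pb, of a] a by (auto simp: sv_comp_def split: if_splits)
    \<comment> \<open>As \<open>F\<close> vanishes at \<open>a\<close>, the composition has the
      value of \<open>X\<close> there: \<open>Pos\<close> at \<open>b\<close> forces
      \<open>Pos\<close> at \<open>a\<close>. Applied to \<open>- X\<close>, this settles
      \<open>Neg\<close>.\<close>
    have pos: "X a = Pos" if "X \<in> L" "X b = Pos" for X
      using comp_gen[OF that, of a] a F0 by (auto simp: sv_comp_def)
    have neg: "X a = Neg" if "X \<in> L" "X b = Neg" for X
      using pos[OF symmetry[OF that(1)]] that by simp
    \<comment> \<open>If \<open>X\<close> were \<open>Neg\<close> at \<open>a\<close> and zero at
      \<open>b\<close>, then \<open>sv_comp X P\<close> would be \<open>Pos\<close> at
      \<open>b\<close> and \<open>Neg\<close> at \<open>a\<close>, against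
      \<open>pos\<close>.\<close>
    have not_neg: "X a \<noteq> Neg" if "X \<in> L" "X b = Zero" for X
      using pos[OF composition[OF that(1) P(1)]] that Pb by (auto simp: sv_comp_def)
    have zero: "X a = Zero" if "X \<in> L" "X b = Zero" for X
      using not_neg[OF that] not_neg[OF symmetry[OF that(1)]] that by (cases "X a") auto
    have "X a = X b" if "X \<in> L" for X
      using pos[OF that] neg[OF that] zero[OF that] by (cases "X b") auto
    moreover have "a \<in> E" "b \<in> E" "a \<noteq> b"
      using a b AE B by auto
    ultimately show False
      using no_parallel by blast
  qed
  thus ?thesis
    using F unfolding om_conv_acyclic[OF ac(3)] by force
qed

text \<open>This is the Krein--Milman property in terms of covectors: an inclusion-minimal
  generating subset \<open>B\<close> of \<open>A\<close> consists of extreme points, so positivity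
  on these gives positivity on \<open>B\<close>, which spreads to its hull.\<close>

lemma pos_on_extreme_points_iff:
  assumes A: "om_convex E L A" and X: "X \<in> L"
  shows "(\<forall>a\<in>extreme_points E L A. X a = Pos) \<longleftrightarrow> (\<forall>a\<in>A. X a = Pos)"
proof
  have acA: "acyclic_set E L A" "om_conv E L A = A"
    using A by (auto simp: om_convex_def)
  \<comment> \<open>The convention \<open>ex(E) = E\<close> does not apply, because \<open>A\<close>
    is acyclic.\<close>
  have ex: "extreme_points E L A = {a \<in> A. a \<notin> om_conv E L (A - {a})}"
    using acA by (auto simp: extreme_points_def)
  show "\<forall>a\<in>A. X a = Pos \<Longrightarrow> \<forall>a\<in>extreme_points E L A. X a = Pos"
    by (simp add: ex)
  have "finite A"
    using acA finite_ground by (auto simp: acyclic_set_def intro: finite_subset)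
  let ?gen = "{B. B \<subseteq> A \<and> A \<subseteq> om_conv E L B}"
  have "finite ?gen" "A \<in> ?gen"
    using \<open>finite A\<close> acA by auto
  hence "\<exists>B\<in>?gen. \<forall>C\<in>?gen. C \<subseteq> B \<longrightarrow> B = C"
    by (intro finite_has_minimal) blast+
  then obtain B where B: "B \<in> ?gen" and min: "\<And>C. C \<in> ?gen \<Longrightarrow> C \<subseteq> B \<Longrightarrow> B = C"
    by meson
  have acB: "acyclic_set E L B"
    using acA B by (auto intro: acyclic_set_mono)
  have "b \<in> extreme_points E L A" if b: "b \<in> B" for b
  proof -
    \<comment> \<open>A redundant \<open>b\<close> could be dropped from \<open>B\<close> with
      \<open>A\<close> still generated, against minimality.\<close>
    have "b \<notin> om_conv E L (B - {b})"
    proof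
      assume *: "b \<in> om_conv E L (B - {b})"
      have ac: "acyclic_set E L (B - {b})"
        using acB by (auto intro: acyclic_set_mono)
      have "Y x = Pos" if "x \<in> A" "Y \<in> L" "\<forall>a\<in>B - {b}. Y a = Pos" for x Y
      proof -
        have "Y b = Pos"
          using pos_on_om_conv[OF ac that(2,3)] * by blast
        thus ?thesis
          using pos_on_om_conv[OF acB that(2)] that B by blast
      qed
      hence "A \<subseteq> om_conv E L (B - {b})"
        using acA by (auto simp: om_conv_acyclic[OF ac] acyclic_set_def)
      hence "B = B - {b}"
        using min[of "B - {b}"] B by blast
      thus False
        using b by blast
    qed
    thus ?thesis
      using irredundant_extreme[OF A, of B b] B b by (auto simp: ex)
  qed
  thus "\<forall>a\<in>A. X a = Pos" if "\<forall>a\<in>extreme_points E L A. X a = Pos"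
    using pos_on_om_conv[OF acB X] that B by blast
qed

section \<open>Regions and the factors of the product\<close>

lemma pos_region_extreme_points:
  assumes "om_convex E L A"
  shows "pos_region L (extreme_points E L A) = {T \<in> topes L. A \<subseteq> pos_part T}"
proof -
  have "pos_region L (extreme_points E L A) = {T \<in> topes L. \<forall>a\<in>extreme_points E L A. T a = Pos}"
    by (auto simp: pos_region_def pos_halfspace_def)
  also have "\<dots> = {T \<in> topes L. \<forall>a\<in>A. T a = Pos}"
    by (intro Collect_cong conj_cong refl pos_on_extreme_points_iff[OF assms])
      (simp add: topes_def)
  finally show ?thesis
    by (simp add: pos_part_def subset_eq)
qed

text \<open>An all-positive covector has no zeros on \<open>E\<close> and is therefore already a
  tope.\<close>

lemma acyclic_om_iff: "acyclic_om E L \<longleftrightarrow> acyclic_set E L E"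
proof -
  have "F \<in> topes L" if "F \<in> L" "\<forall>a\<in>E. F a = Pos" for F
    using that by (intro full_support_tope) auto
  thus ?thesis
    by (auto simp: acyclic_om_def acyclic_set_iff topes_def)
qed

lemma pos_region_Int_uminus_pos_region:
  assumes nac: "\<not> acyclic_om E L" and A: "om_convex E L A"
  shows "pos_region L (extreme_points E L A)
      \<inter> uminus ` pos_region L (extreme_points E L (om_conv E L (E - A)))
    = {T \<in> topes L. pos_part T = A}"
proof -
  have uminus_image: "uminus ` {T \<in> topes L. Q T} = {T \<in> topes L. Q (- T)}" for Q
    using uminus_topes by (auto intro!: image_eqI[where x = "- _"])
  have AE: "A \<subseteq> E"
    using A by (simp add: om_convex_def acyclic_set_def)
  show ?thesis
  proof (cases "acyclic_set E L (E - A)")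
    case True
    \<comment> \<open>Passing to the hull imposes no further condition on a covector.\<close>
    have "om_conv E L (E - A) \<subseteq> pos_part T \<longleftrightarrow> E - A \<subseteq> pos_part T" if "T \<in> topes L" for T
      using subset_om_conv[OF True] pos_on_om_conv[OF True, of T] that
      by (auto simp: pos_part_def topes_def)
    hence "{T \<in> topes L. om_conv E L (E - A) \<subseteq> pos_part (- T)}
        = {T \<in> topes L. E - A \<subseteq> pos_part (- T)}"
      using uminus_topes by blast
    also have "\<dots> = {T \<in> topes L. E - A \<subseteq> E - pos_part T}"
      using pos_part_uminus by auto
    finally have "uminus ` pos_region L (extreme_points E L (om_conv E L (E - A)))
        = {T \<in> topes L. E - A \<subseteq> E - pos_part T}"
      unfolding pos_region_extreme_points[OF om_convex_om_conv[OF True]] uminus_image .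
    moreover have "pos_part T \<subseteq> E" if "T \<in> topes L" for T
      using that pos_part_subset by (simp add: topes_def)
    ultimately show ?thesis
      using AE unfolding pos_region_extreme_points[OF A] by fast
  next
    case False
    \<comment> \<open>Here \<open>conv(E - A) = E\<close> and \<open>ex(E) = E\<close>, so the
      second region asks for an all-positive tope; there is none.\<close>
    have "om_conv E L (E - A) = E"
      using False by (simp add: om_conv_def)
    hence "extreme_points E L (om_conv E L (E - A)) = E"
      using nac by (simp add: extreme_points_def acyclic_om_iff)
    moreover have "pos_region L E = {}"
      using nac by (auto simp: pos_region_def pos_halfspace_def acyclic_om_def)
    \<comment> \<open>The negative of such a tope would be positive on exactly \<open>E - A\<close>
      and make that set acyclic.\<close>
    moreover have "pos_part T \<noteq> A" if T: "T \<in> topes L" for T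
    proof
      assume "pos_part T = A"
      hence "pos_part (- T) = E - A"
        using pos_part_uminus[OF T] by simp
      moreover have "- T \<in> L"
        using uminus_topes[OF T] by (simp add: topes_def)
      ultimately show False
        using om_convex_pos_part False by (metis om_convex_def)
    qed
    ultimately show ?thesis
      by auto
  qed
qed

lemma card_pos_region_Int_uminus_pos_region:
  assumes "\<not> acyclic_om E L" "om_convex E L A"
  shows "card (pos_region L (extreme_points E L A)
      \<inter> uminus ` pos_region L (extreme_points E L (om_conv E L (E - A))))
    = of_bool (A \<in> pos_part ` topes L)"
proof (cases "A \<in> pos_part ` topes L")
  case True
  then obtain T where "T \<in> topes L" "pos_part T = A"
    by blast
  hence "{T \<in> topes L. pos_part T = A} = {T}"
    using inj_on_pos_part by (auto dest: inj_onD)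
  thus ?thesis
    using True pos_region_Int_uminus_pos_region[OF assms] by simp
next
  case False
  hence empty: "{T \<in> topes L. pos_part T = A} = {}"
    by blast
  thus ?thesis
    unfolding pos_region_Int_uminus_pos_region[OF assms] empty using False by simp
qed

section \<open>Committees and anti-committees of size three\<close>

text \<open>At each \<open>e\<close> a strict majority of three negated topes means that at least
  two of the topes are \<open>Neg\<close> at \<open>e\<close>. Topes have no zeros on
  \<open>E\<close>, so this says that no two of them are \<open>Pos\<close> at
  \<open>e\<close>.\<close>

lemma anticommittees_3_iff:
  "K \<in> anticommittees 3 E L \<longleftrightarrow> K \<subseteq> topes L \<and> card K = 3 \<and>
    (\<forall>S\<in>K. \<forall>T\<in>K. S \<noteq> T \<longrightarrow> pos_part S \<inter> pos_part T = {})"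
proof (cases "K \<subseteq> topes L \<and> card K = 3")
  case True
  then obtain T1 T2 T3 where K: "K = {T1, T2, T3}" "T1 \<noteq> T2" "T1 \<noteq> T3" "T2 \<noteq> T3"
    by (auto simp: card_3_iff)
  have topes: "T1 \<in> topes L" "T2 \<in> topes L" "T3 \<in> topes L"
    using True K by auto
  have card_uK: "card (uminus ` K) = 3"
    using True by (simp add: card_image inj_on_subset[OF inj_uminus_sign_vector])
  have half: "real (card (pos_halfspace L e \<inter> uminus ` K)) > 1 / 2 * real (card (uminus ` K))
      \<longleftrightarrow> (\<forall>S\<in>K. \<forall>T\<in>K. S \<noteq> T \<longrightarrow> \<not> (S e = Pos \<and> T e = Pos))" if e: "e \<in> E" for e
  proof -
    have "pos_halfspace L e \<inter> uminus ` K = uminus ` {T \<in> K. T e = Neg}"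
      using True uminus_topes by (auto simp: pos_halfspace_def)
    hence "card (pos_halfspace L e \<inter> uminus ` K) = card {T \<in> K. T e = Neg}"
      by (simp add: card_image inj_on_subset[OF inj_uminus_sign_vector])
    \<comment> \<open>Writing the count as three indicators leaves a finite check over the signs of
      \<open>T1\<close>, \<open>T2\<close>, \<open>T3\<close> at \<open>e\<close>.\<close>
    also have "{T \<in> K. T e = Neg} = (if T1 e = Neg then {T1} else {})
        \<union> (if T2 e = Neg then {T2} else {}) \<union> (if T3 e = Neg then {T3} else {})"
      using K by auto
    also have "card \<dots> = of_bool (T1 e = Neg) + of_bool (T2 e = Neg) + of_bool (T3 e = Neg)"
      using K by auto
    finally have card: "card (pos_halfspace L e \<inter> uminus ` K) = \<dots>" .
    have pairs: "(\<forall>S\<in>K. \<forall>T\<in>K. S \<noteq> T \<longrightarrow> \<not> (S e = Pos \<and> T e = Pos)) \<longleftrightarrow>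
        \<not> (T1 e = Pos \<and> T2 e = Pos) \<and> \<not> (T1 e = Pos \<and> T3 e = Pos) \<and> \<not> (T2 e = Pos \<and> T3 e = Pos)"
      using K by auto
    have "T1 e \<noteq> Zero" "T2 e \<noteq> Zero" "T3 e \<noteq> Zero"
      using tope_nonzero topes e by auto
    thus ?thesis
      unfolding card pairs card_uK by (cases "T1 e"; cases "T2 e"; cases "T3 e") auto
  qed
  have "uminus ` K \<subseteq> topes L"
    using True uminus_topes by blast
  hence "K \<in> anticommittees 3 E L \<longleftrightarrow>
      (\<forall>e\<in>E. real (card (pos_halfspace L e \<inter> uminus ` K)) > 1 / 2 * real (card (uminus ` K)))"
    using True unfolding anticommittees_def tope_anticommittee_def tope_committee_def by blast
  also have "\<dots> \<longleftrightarrow> (\<forall>e\<in>E. \<forall>S\<in>K. \<forall>T\<in>K. S \<noteq> T \<longrightarrow> \<not> (S e = Pos \<and> T e = Pos))"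
    by (intro ball_cong refl half)
  \<comment> \<open>Positive parts lie in \<open>E\<close>, so testing the elements of
    \<open>E\<close> decides disjointness.\<close>
  also have "\<dots> \<longleftrightarrow> (\<forall>S\<in>K. \<forall>T\<in>K. S \<noteq> T \<longrightarrow> pos_part S \<inter> pos_part T = {})"
  proof -
    have "pos_part S \<subseteq> E" if "S \<in> K" for S
      using True that pos_part_subset by (auto simp: topes_def)
    thus ?thesis
      by (fastforce simp: pos_part_def)
  qed
  finally show ?thesis
    using True by blast
qed (auto simp: anticommittees_def tope_anticommittee_def)

text \<open>Negating every tope is its own inverse and preserves cardinality, so it swaps the two
  families.\<close>

lemma bij_betw_committees_anticommittees:
  "bij_betw (image uminus) (committees k E L) (anticommittees k E L)"
proof (rule bij_betw_byWitness[where f' = "image uminus"])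
  have card: "card (uminus ` K) = card K" for K :: "'a sign_vector set"
    by (simp add: card_image inj_on_subset[OF inj_uminus_sign_vector])
  show "image uminus ` committees k E L \<subseteq> anticommittees k E L"
    using uminus_topes card
    by (auto simp: committees_def anticommittees_def tope_anticommittee_def tope_committee_def)
  show "image uminus ` anticommittees k E L \<subseteq> committees k E L"
    using card by (auto simp: committees_def anticommittees_def tope_anticommittee_def)
qed auto

end

section \<open>Counting triples of positive parts\<close>

theorem mainTheorem2:
  fixes E :: "'e set" and L :: "'e sign_vector set"
  assumes "simple_oriented_matroid E L"
    and "\<not> acyclic_om E L"
  shows "card (committees 3 E L) = card (anticommittees 3 E L)
    \<and> card (anticommittees 3 E L) =
      (\<Sum>S \<in> {S. S \<subseteq> carrier (convex_lattice E L) - {\<bottom>\<^bsub>convex_lattice E L\<^esub>, \<top>\<^bsub>convex_lattice E L\<^esub>}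
                 \<and> card S = 3
                 \<and> (\<forall>A\<in>S. \<forall>B\<in>S. A \<noteq> B \<longrightarrow>
                      A \<sqinter>\<^bsub>convex_lattice E L\<^esub> B = \<bottom>\<^bsub>convex_lattice E L\<^esub>)}.
         \<Prod>A\<in>S. card (pos_region L (extreme_points E L A)
                 \<inter> uminus ` pos_region L (extreme_points E L (om_conv E L (E - A)))))"
proof -
  interpret simple_oriented_matroid E L
    by (rule assms(1))
  note nac = assms(2)
  let ?P = "pos_part ` topes L"
  define I where "I = {S. S \<subseteq> carrier (convex_lattice E L) - {\<bottom>\<^bsub>convex_lattice E L\<^esub>, \<top>\<^bsub>convex_lattice E L\<^esub>}
                 \<and> card S = 3
                 \<and> (\<forall>A\<in>S. \<forall>B\<in>S. A \<noteq> B \<longrightarrow>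
                      A \<sqinter>\<^bsub>convex_lattice E L\<^esub> B = \<bottom>\<^bsub>convex_lattice E L\<^esub>)}"
  have carrier: "carrier (convex_lattice E L) - {\<bottom>\<^bsub>convex_lattice E L\<^esub>, \<top>\<^bsub>convex_lattice E L\<^esub>}
      = {A. om_convex E L A} - {{}, E}"
    unfolding convex_lattice_bottom convex_lattice_top by (auto simp: convex_lattice_def)
  \<comment> \<open>In plain set terms: bottom is \<open>{}\<close>, top is \<open>E\<close>, and
    meets of members are intersections since all are convex.\<close>
  have I_iff: "S \<in> I \<longleftrightarrow> S \<subseteq> {A. om_convex E L A} - {{}, E} \<and> card S = 3
      \<and> (\<forall>A\<in>S. \<forall>B\<in>S. A \<noteq> B \<longrightarrow> A \<inter> B = {})" for S
    unfolding I_def mem_Collect_eq carrier unfolding convex_lattice_bottom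
    by (intro conj_cong ball_cong imp_cong refl) (auto simp: convex_lattice_meet subset_iff)
  note I_D = I_iff[THEN iffD1, THEN conjunct1] I_iff[THEN iffD1, THEN conjunct2, THEN conjunct1]
    I_iff[THEN iffD1, THEN conjunct2, THEN conjunct2]
  have "I \<subseteq> Pow (Pow E)"
    unfolding subset_iff I_iff by (auto simp: om_convex_def acyclic_set_def)
  hence fin_I: "finite I"
    using finite_ground by (auto intro: finite_subset)
  \<comment> \<open>A tope with positive part \<open>E\<close> would make the oriented matroid
    acyclic; one with empty positive part would have such a negative. So positive parts of topes
    avoid bottom and top.\<close>
  have P: "?P \<subseteq> {A. om_convex E L A} - {{}, E}"
  proof -
    have "pos_part T \<noteq> E" if "T \<in> topes L" for T
      using nac that by (auto simp: acyclic_om_def pos_part_def)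
    moreover from this[OF uminus_topes] have "pos_part T \<noteq> {}" if "T \<in> topes L" for T
      using that pos_part_uminus by fastforce
    ultimately show ?thesis
      using om_convex_pos_part by (auto simp: topes_def)
  qed
  \<comment> \<open>Three topes correspond to their three positive parts; injectivity of
    \<open>pos_part\<close> keeps them distinct.\<close>
  have "bij_betw (image pos_part) (anticommittees 3 E L) {S \<in> I. S \<subseteq> ?P}"
    unfolding bij_betw_def
  proof
    show "inj_on (image pos_part) (anticommittees 3 E L)"
      by (intro inj_onI) (metis anticommittees_3_iff inj_on_image_eq_iff inj_on_pos_part)
    have image_in: "pos_part ` K \<in> {S \<in> I. S \<subseteq> ?P}" if "K \<in> anticommittees 3 E L" for K
    proof -
      have K: "K \<subseteq> topes L" "card K = 3"
        "\<And>S T. S \<in> K \<Longrightarrow> T \<in> K \<Longrightarrow> S \<noteq> T \<Longrightarrow> pos_part S \<inter> pos_part T = {}"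
        using that by (auto simp: anticommittees_3_iff)
      have "card (pos_part ` K) = 3"
        using K inj_on_pos_part by (metis card_image inj_on_subset)
      moreover have "pos_part ` K \<subseteq> ?P"
        using K by blast
      moreover have "\<forall>A\<in>pos_part ` K. \<forall>B\<in>pos_part ` K. A \<noteq> B \<longrightarrow> A \<inter> B = {}"
        using K(3) by blast
      ultimately show ?thesis
        using I_iff subset_trans[OF _ P] by (metis (mono_tags, lifting) mem_Collect_eq)
    qed
    have in_image: "S \<in> image pos_part ` anticommittees 3 E L" if "S \<in> {S \<in> I. S \<subseteq> ?P}" for S
    proof -
      have "S \<in> I" and SP: "S \<subseteq> ?P"
        using that by simp_all
      note S = I_D(2,3)[OF \<open>S \<in> I\<close>]
      obtain K where K: "K \<subseteq> topes L" "S = pos_part ` K"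
        using SP by (rule subset_imageE)
      have inj: "inj_on pos_part K"
        by (rule inj_on_subset[OF inj_on_pos_part K(1)])
      hence "card K = 3"
        using S(1) card_image unfolding K(2) by metis
      moreover have "\<forall>S\<in>K. \<forall>T\<in>K. S \<noteq> T \<longrightarrow> pos_part S \<inter> pos_part T = {}"
        using S(2) inj unfolding K(2) by (metis imageI inj_onD)
      ultimately have "K \<in> anticommittees 3 E L"
        using K(1) unfolding anticommittees_3_iff by blast
      thus ?thesis
        using K(2) by blast
    qed
    show "image pos_part ` anticommittees 3 E L = {S \<in> I. S \<subseteq> ?P}"
      by (intro equalityI image_subsetI subsetI image_in in_image)
  qed
  hence "card (anticommittees 3 E L) = card {S \<in> I. S \<subseteq> ?P}"
    by (rule bij_betw_same_card)
  \<comment> \<open>All other triples enter with the value 0, which matches a vanishing factor in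
    the product.\<close>
  also have "\<dots> = (\<Sum>S\<in>I. of_bool (S \<subseteq> ?P))"
    by (subst sum_of_bool_eq) (simp_all add: fin_I Int_def)
  also have "\<dots> = (\<Sum>S\<in>I. \<Prod>A\<in>S. card (pos_region L (extreme_points E L A)
                 \<inter> uminus ` pos_region L (extreme_points E L (om_conv E L (E - A)))))"
  proof (intro sum.cong refl)
    fix S
    assume "S \<in> I"
    note S = I_D(1,2)[OF this]
    have fin: "finite S"
      using S(2) by (intro card_ge_0_finite) simp
    have "of_bool (S \<subseteq> ?P) = (\<Prod>A\<in>S. of_bool (A \<in> ?P) :: nat)"
      using fin by (rule of_bool_subset_eq_prod)
    also have "\<dots> = (\<Prod>A\<in>S. card (pos_region L (extreme_points E L A)
                 \<inter> uminus ` pos_region L (extreme_points E L (om_conv E L (E - A)))))"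
    proof (rule prod.cong[OF refl])
      fix A
      assume "A \<in> S"
      hence "om_convex E L A"
        using S(1) by blast
      thus "of_bool (A \<in> ?P) = card (pos_region L (extreme_points E L A)
                 \<inter> uminus ` pos_region L (extreme_points E L (om_conv E L (E - A))))"
        by (rule card_pos_region_Int_uminus_pos_region[OF nac, symmetric])
    qed
    finally show "of_bool (S \<subseteq> ?P) = (\<Prod>A\<in>S. card (pos_region L (extreme_points E L A)
                 \<inter> uminus ` pos_region L (extreme_points E L (om_conv E L (E - A)))))" .
  qed
  finally show ?thesis
    unfolding I_def using bij_betw_same_card[OF bij_betw_committees_anticommittees] by blast
qed

end
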